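(* Let $G$ be an internal groupoid in $\mathsf{C}$ and $N$ an internal normal subgroupoid of $G$. Then the crossed module corresponding to $N$ is a normal subcrossed module of the crossed module corresponding to $G$.
   Context: Groups with operations. $\mathsf{C}$ is a fixed category of groups with operations: its objects are the algebras with a set $\Omega$ of operations satisfying a set $\mathsf{E}$ of identities, where $\mathsf{E}$ includes the group laws and, with $\Omega_i$ the set of $i$-ary operations: (a) $\Omega=\Omega_0\cup\Omega_1\cup\Omega_2$; (b) the group operations $0,-,+$ (written additively, $+$ not necessarily commutative) belong to $\Omega_0,\Omega_1,\Omega_2$ respectively, $\Omega_0=\{0\}$, and with $\Omega_1'=\Omega_1\setminus\{-\}$, $\Omega_2'=\Omega_2\setminus\{+\}$, if $\star\in\Omega_2'$ then the operation $a\star^{\circ}b=b\star a$ is also in $\Omega_2'$; (c) for each $\star\in\Omega_2'$, $\mathsf{E}$ includes $a\star(b+c)=a\star b+a\star c$; (d) for $\omega\in\Omega_1'$, $\star\in\Omega_2'$, $\mathsf{E}$ includes $\omega(a+b)=\omega(a)+\omega(b)$ and $\omega(a)\star b=\omega(a\star b)$. Morphisms are group homomorphisms preserving all operations in $\Omega_1'$ and $\Omega_2'$. A subobject is a subset containing $0$ and closed under all operations. An ideal $N$ of $A$ is a subobject with $(N,+)$ normal in $(A,+)$ and $a\star n\in N$ for all $a\in A$, $n\in N$, $\star\in\Omega_2'$. Crossed modules. Derived actions of $B$ on $A$ (objects of $\mathsf{C}$) are the maps $b\cdot a=s(b)+a-s(b)$ and $b\star a=s(b)\star a$ ($\star\in\Omega_2'$)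 obtained from a split extension $0\to A\to E\xrightarrow{p}B\to 0$ in $\mathsf{C}$ ($p$ surjective, $A=\ker p$, $s\colon B\to E$ a morphism with $ps=\mathrm{id}_B$). One writes $a\star b:=b\star^{\circ}a$. A crossed module $(A,B,\alpha)$ in $\mathsf{C}$ consists of objects $A,B$, derived actions of $B$ on $A$, and a morphism $\alpha\colon A\to B$ such that for all $b\in B$, $a,a'\in A$, $\star\in\Omega_2'$: $\alpha(b\cdot a)=b+\alpha(a)-b$; $\alpha(a)\cdot a'=a+a'-a$; $\alpha(a)\star a'=a\star a'$; $\alpha(b\star a)=b\star\alpha(a)$ and $\alpha(a\star b)=\alpha(a)\star b$. A crossed module $(S,T,\sigma)$ is a subcrossed module of $(A,B,\alpha)$ if $S\subseteq A$ and $T\subseteq B$ are subobjects, $\sigma$ is the restriction of $\alpha$, and the actions of $T$ on $S$ are induced by those of $B$ on $A$. It is normal if: $T$ is an ideal of $B$; $b\cdot s\in S$, $(t\cdot a)-a\in S$, $b\star s\in S$, $t\star a\in S$ for all $b\in B,s\in S,t\in T,a\in A$, $\star\in\Omega_2'$. Internal groupoids. An internal groupoid $G$ in $\mathsf{C}$ is a groupoid whose set of objects $G_0$ and set of morphisms $G_1$ are objects of $\mathsf{C}$ and whose source and target maps $d_0,d_1\colon G_1\to G_0$, identity map $\epsilon\colon G_0\to G_1$, $x\mapsto 1_x$, and partial composition are morphisms in $\mathsf{C}$. A subgroupoid $N$ of $G$ (subsets $N_1\subseteq G_1$, $N_0\subseteq G_0$ closed under source, target, identities, composition and inversion) is an internal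 normal subgroupoid if $N_1$ is an ideal of $G_1$ (then $N_0$ is an ideal of $G_0$). The crossed module corresponding to an internal groupoid $G$ is $(\ker d_0, G_0, d_1|_{\ker d_0})$ with actions $b\cdot a=1_b+a-1_b$ and $b\star a=1_b\star a$. *)

theory Defs
  imports "HOL-Algebra.Coset"
begin

section \<open>Groups with operations\<close>

text \<open>
  Terms in variables indexed by \<open>nat\<close> over a signature whose operation symbols are $0$, $-$, $+$ (built in), the symbols of
  \<open>\<Omega>\<^sub>1'\<close> (of type \<open>'u\<close>) and the symbols of \<open>\<Omega>\<^sub>2'\<close> (of type \<open>'b\<close>).
\<close>

datatype ('u, 'b) gterm =
    Var nat
  | Zero
  | Neg "('u, 'b) gterm"
  | Add "('u, 'b) gterm" "('u, 'b) gterm"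
  | UnOp 'u "('u, 'b) gterm"
  | BinOp 'b "('u, 'b) gterm" "('u, 'b) gterm"

type_synonym ('u, 'b) identity = "('u, 'b) gterm \<times> ('u, 'b) gterm"

text \<open>
  The sets \<open>Om1\<close>, \<open>Om2\<close> are \<open>\<Omega>\<^sub>1' = \<Omega>\<^sub>1 - {-}\<close> and \<open>\<Omega>\<^sub>2' = \<Omega>\<^sub>2 - {+}\<close>; they may be empty.
  The symbol \<open>opp T \<star>\<close> is $\star^\circ$, and \<open>Ids\<close> is the set $\mathsf{E}$.
\<close>

record ('u, 'b) gwo_theory =
  Om1 :: "'u set"
  Om2 :: "'b set"
  opp :: "'b \<Rightarrow> 'b"
  Ids :: "('u, 'b) identity set"

fun gterm_over :: "('u, 'b) gwo_theory \<Rightarrow> ('u, 'b) gterm \<Rightarrow> bool" where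
  "gterm_over T (Var n) = True"
| "gterm_over T Zero = True"
| "gterm_over T (Neg t) = gterm_over T t"
| "gterm_over T (Add s t) = (gterm_over T s \<and> gterm_over T t)"
| "gterm_over T (UnOp w t) = (w \<in> Om1 T \<and> gterm_over T t)"
| "gterm_over T (BinOp f s t) = (f \<in> Om2 T \<and> gterm_over T s \<and> gterm_over T t)"

definition group_laws :: "('u, 'b) identity set" where
  "group_laws =
    {(Add (Add (Var 0) (Var 1)) (Var 2), Add (Var 0) (Add (Var 1) (Var 2))),
     (Add Zero (Var 0), Var 0),
     (Add (Var 0) Zero, Var 0),
     (Add (Neg (Var 0)) (Var 0), Zero),
     (Add (Var 0) (Neg (Var 0)), Zero)}"

definition groups_with_operations :: "('u, 'b) gwo_theory \<Rightarrow> bool" where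
  "groups_with_operations T \<longleftrightarrow>
     (\<forall>(l, r) \<in> Ids T. gterm_over T l \<and> gterm_over T r) \<and>
     group_laws \<subseteq> Ids T \<and>
     (\<forall>f \<in> Om2 T. opp T f \<in> Om2 T \<and>
        (BinOp (opp T f) (Var 0) (Var 1), BinOp f (Var 1) (Var 0)) \<in> Ids T) \<and>
     (\<forall>f \<in> Om2 T.
        (BinOp f (Var 0) (Add (Var 1) (Var 2)),
         Add (BinOp f (Var 0) (Var 1)) (BinOp f (Var 0) (Var 2))) \<in> Ids T) \<and>
     (\<forall>w \<in> Om1 T.
        (UnOp w (Add (Var 0) (Var 1)), Add (UnOp w (Var 0)) (UnOp w (Var 1))) \<in> Ids T) \<and>
     (\<forall>w \<in> Om1 T. \<forall>f \<in> Om2 T.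
        (BinOp f (UnOp w (Var 0)) (Var 1), UnOp w (BinOp f (Var 0) (Var 1))) \<in> Ids T)"

record ('a, 'u, 'b) gwo_alg = "'a partial_object" +
  gzero :: 'a
  gneg :: "'a \<Rightarrow> 'a"
  gadd :: "'a \<Rightarrow> 'a \<Rightarrow> 'a"
  gun :: "'u \<Rightarrow> 'a \<Rightarrow> 'a"
  gbin :: "'b \<Rightarrow> 'a \<Rightarrow> 'a \<Rightarrow> 'a"

fun gval :: "('a, 'u, 'b) gwo_alg \<Rightarrow> (nat \<Rightarrow> 'a) \<Rightarrow> ('u, 'b) gterm \<Rightarrow> 'a" where
  "gval A v (Var n) = v n"
| "gval A v Zero = gzero A"
| "gval A v (Neg t) = gneg A (gval A v t)"
| "gval A v (Add s t) = gadd A (gval A v s) (gval A v t)"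
| "gval A v (UnOp w t) = gun A w (gval A v t)"
| "gval A v (BinOp f s t) = gbin A f (gval A v s) (gval A v t)"

definition closed_under :: "('u, 'b) gwo_theory \<Rightarrow> ('a, 'u, 'b) gwo_alg \<Rightarrow> 'a set \<Rightarrow> bool" where
  "closed_under T A N \<longleftrightarrow>
     gzero A \<in> N \<and>
     (\<forall>x \<in> N. gneg A x \<in> N) \<and>
     (\<forall>x \<in> N. \<forall>y \<in> N. gadd A x y \<in> N) \<and>
     (\<forall>w \<in> Om1 T. \<forall>x \<in> N. gun A w x \<in> N) \<and>
     (\<forall>f \<in> Om2 T. \<forall>x \<in> N. \<forall>y \<in> N. gbin A f x y \<in> N)"

definition gwo_object :: "('u, 'b) gwo_theory \<Rightarrow> ('a, 'u, 'b) gwo_alg \<Rightarrow> bool" where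
  "gwo_object T A \<longleftrightarrow>
     closed_under T A (carrier A) \<and>
     (\<forall>(l, r) \<in> Ids T. \<forall>v. range v \<subseteq> carrier A \<longrightarrow> gval A v l = gval A v r)"

definition add_group :: "('a, 'u, 'b) gwo_alg \<Rightarrow> 'a monoid" where
  "add_group A = \<lparr>carrier = carrier A, mult = gadd A, one = gzero A\<rparr>"

definition gsub :: "('a, 'u, 'b) gwo_alg \<Rightarrow> 'a \<Rightarrow> 'a \<Rightarrow> 'a" where
  "gsub A x y = gadd A x (gneg A y)"

definition gwo_morphism ::
  "('u, 'b) gwo_theory \<Rightarrow> ('a, 'u, 'b) gwo_alg \<Rightarrow> ('c, 'u, 'b) gwo_alg \<Rightarrow> ('a \<Rightarrow> 'c) \<Rightarrow> bool" where
  "gwo_morphism T A B h \<longleftrightarrow>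
     h \<in> hom (add_group A) (add_group B) \<and>
     (\<forall>w \<in> Om1 T. \<forall>x \<in> carrier A. h (gun A w x) = gun B w (h x)) \<and>
     (\<forall>f \<in> Om2 T. \<forall>x \<in> carrier A. \<forall>y \<in> carrier A. h (gbin A f x y) = gbin B f (h x) (h y))"

definition subobject :: "('u, 'b) gwo_theory \<Rightarrow> 'a set \<Rightarrow> ('a, 'u, 'b) gwo_alg \<Rightarrow> bool" where
  "subobject T N A \<longleftrightarrow> N \<subseteq> carrier A \<and> closed_under T A N"

definition gwo_ideal :: "('u, 'b) gwo_theory \<Rightarrow> 'a set \<Rightarrow> ('a, 'u, 'b) gwo_alg \<Rightarrow> bool" where
  "gwo_ideal T N A \<longleftrightarrow>
     subobject T N A \<and> N \<lhd> add_group A \<and>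
     (\<forall>f \<in> Om2 T. \<forall>a \<in> carrier A. \<forall>n \<in> N. gbin A f a n \<in> N)"

definition gwo_kernel :: "('a, 'u, 'b) gwo_alg \<Rightarrow> ('c, 'u, 'b) gwo_alg \<Rightarrow> ('a \<Rightarrow> 'c) \<Rightarrow> 'a set" where
  "gwo_kernel A B h = kernel (add_group A) (add_group B) h"


section \<open>Derived actions and crossed modules\<close>

definition split_extension ::
  "('u, 'b) gwo_theory \<Rightarrow> ('a, 'u, 'b) gwo_alg \<Rightarrow> ('e, 'u, 'b) gwo_alg \<Rightarrow> ('c, 'u, 'b) gwo_alg
    \<Rightarrow> ('a \<Rightarrow> 'e) \<Rightarrow> ('e \<Rightarrow> 'c) \<Rightarrow> ('c \<Rightarrow> 'e) \<Rightarrow> bool" where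
  "split_extension T A E B i p s \<longleftrightarrow>
     gwo_object T A \<and> gwo_object T E \<and> gwo_object T B \<and>
     gwo_morphism T A E i \<and> gwo_morphism T E B p \<and> gwo_morphism T B E s \<and>
     inj_on i (carrier A) \<and> i ` carrier A = gwo_kernel E B p \<and>
     p ` carrier E = carrier B \<and>
     (\<forall>b \<in> carrier B. p (s b) = b)"

definition actions_from ::
  "('u, 'b) gwo_theory \<Rightarrow> ('a, 'u, 'b) gwo_alg \<Rightarrow> ('e, 'u, 'b) gwo_alg \<Rightarrow> ('c, 'u, 'b) gwo_alg
    \<Rightarrow> ('a \<Rightarrow> 'e) \<Rightarrow> ('c \<Rightarrow> 'e) \<Rightarrow> ('c \<Rightarrow> 'a \<Rightarrow> 'a) \<Rightarrow> ('b \<Rightarrow> 'c \<Rightarrow> 'a \<Rightarrow> 'a) \<Rightarrow> bool" where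
  "actions_from T A E B i s dot star \<longleftrightarrow>
     (\<forall>b \<in> carrier B. \<forall>a \<in> carrier A.
        dot b a \<in> carrier A \<and>
        i (dot b a) = gsub E (gadd E (s b) (i a)) (s b) \<and>
        (\<forall>f \<in> Om2 T. star f b a \<in> carrier A \<and> i (star f b a) = gbin E f (s b) (i a)))"

text \<open>
  HOL cannot quantify existentially over the type of the middle object $E$. Since every element of
  $E$ is $i(a) + s(b)$ for unique $a$, $b$, a copy of $E$ lives on the type \<open>'a \<times> 'c\<close>, so fixing
  that type loses nothing: lemma \<open>derived_actionsI\<close> below accepts $E$ over an arbitrary type.
\<close>

definition derived_actions ::
  "('u, 'b) gwo_theory \<Rightarrow> ('a, 'u, 'b) gwo_alg \<Rightarrow> ('c, 'u, 'b) gwo_alg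
    \<Rightarrow> ('c \<Rightarrow> 'a \<Rightarrow> 'a) \<Rightarrow> ('b \<Rightarrow> 'c \<Rightarrow> 'a \<Rightarrow> 'a) \<Rightarrow> bool" where
  "derived_actions T A B dot star \<longleftrightarrow>
     (\<exists>(E :: ('a \<times> 'c, 'u, 'b) gwo_alg) i p s.
        split_extension T A E B i p s \<and> actions_from T A E B i s dot star)"

text \<open>\<open>cm_dot X b a\<close> is $b \cdot a$ and \<open>cm_star X \<star> b a\<close> is $b \star a$.\<close>

record ('a, 'c, 'u, 'b) crossed_mod =
  cm_top :: "('a, 'u, 'b) gwo_alg"
  cm_base :: "('c, 'u, 'b) gwo_alg"
  cm_map :: "'a \<Rightarrow> 'c"
  cm_dot :: "'c \<Rightarrow> 'a \<Rightarrow> 'a"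
  cm_star :: "'b \<Rightarrow> 'c \<Rightarrow> 'a \<Rightarrow> 'a"

text \<open>The last clause is $\alpha(a \star b) = \alpha(a) \star b$, with $a \star b := b \star^\circ a$.\<close>

definition crossed_module ::
  "('u, 'b) gwo_theory \<Rightarrow> ('a, 'c, 'u, 'b) crossed_mod \<Rightarrow> bool" where
  "crossed_module T X \<longleftrightarrow>
     (let A = cm_top X; B = cm_base X; \<alpha> = cm_map X; dot = cm_dot X; star = cm_star X in
       gwo_object T A \<and> gwo_object T B \<and>
       derived_actions T A B dot star \<and>
       gwo_morphism T A B \<alpha> \<and>
       (\<forall>b \<in> carrier B. \<forall>a \<in> carrier A. \<alpha> (dot b a) = gsub B (gadd B b (\<alpha> a)) b) \<and>
       (\<forall>a \<in> carrier A. \<forall>a' \<in> carrier A. dot (\<alpha> a) a' = gsub A (gadd A a a') a) \<and>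
       (\<forall>f \<in> Om2 T. \<forall>a \<in> carrier A. \<forall>a' \<in> carrier A. star f (\<alpha> a) a' = gbin A f a a') \<and>
       (\<forall>f \<in> Om2 T. \<forall>b \<in> carrier B. \<forall>a \<in> carrier A.
          \<alpha> (star f b a) = gbin B f b (\<alpha> a) \<and>
          \<alpha> (star (opp T f) b a) = gbin B f (\<alpha> a) b))"

text \<open>An object \<open>S\<close>, given as an algebra of its own, that is a subobject of \<open>A\<close>.\<close>

definition subalgebra ::
  "('u, 'b) gwo_theory \<Rightarrow> ('a, 'u, 'b) gwo_alg \<Rightarrow> ('a, 'u, 'b) gwo_alg \<Rightarrow> bool" where
  "subalgebra T S A \<longleftrightarrow>
     subobject T (carrier S) A \<and>
     gzero S = gzero A \<and>
     (\<forall>x \<in> carrier S. gneg S x = gneg A x) \<and>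
     (\<forall>x \<in> carrier S. \<forall>y \<in> carrier S. gadd S x y = gadd A x y) \<and>
     (\<forall>w \<in> Om1 T. \<forall>x \<in> carrier S. gun S w x = gun A w x) \<and>
     (\<forall>f \<in> Om2 T. \<forall>x \<in> carrier S. \<forall>y \<in> carrier S. gbin S f x y = gbin A f x y)"

definition subcrossed_module ::
  "('u, 'b) gwo_theory \<Rightarrow> ('a, 'c, 'u, 'b) crossed_mod \<Rightarrow> ('a, 'c, 'u, 'b) crossed_mod \<Rightarrow> bool" where
  "subcrossed_module T Y X \<longleftrightarrow>
     crossed_module T Y \<and> crossed_module T X \<and>
     subalgebra T (cm_top Y) (cm_top X) \<and>
     subalgebra T (cm_base Y) (cm_base X) \<and>
     (\<forall>s \<in> carrier (cm_top Y). cm_map Y s = cm_map X s) \<and>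
     (\<forall>t \<in> carrier (cm_base Y). \<forall>s \<in> carrier (cm_top Y).
        cm_dot Y t s = cm_dot X t s \<and>
        (\<forall>f \<in> Om2 T. cm_star Y f t s = cm_star X f t s))"

definition normal_subcrossed_module ::
  "('u, 'b) gwo_theory \<Rightarrow> ('a, 'c, 'u, 'b) crossed_mod \<Rightarrow> ('a, 'c, 'u, 'b) crossed_mod \<Rightarrow> bool" where
  "normal_subcrossed_module T Y X \<longleftrightarrow>
     subcrossed_module T Y X \<and>
     (let A = cm_top X; B = cm_base X; S = carrier (cm_top Y); N = carrier (cm_base Y) in
       gwo_ideal T N B \<and>
       (\<forall>b \<in> carrier B. \<forall>s \<in> S. cm_dot X b s \<in> S) \<and>
       (\<forall>t \<in> N. \<forall>a \<in> carrier A. gsub A (cm_dot X t a) a \<in> S) \<and>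
       (\<forall>f \<in> Om2 T. \<forall>b \<in> carrier B. \<forall>s \<in> S. cm_star X f b s \<in> S) \<and>
       (\<forall>f \<in> Om2 T. \<forall>t \<in> N. \<forall>a \<in> carrier A. cm_star X f t a \<in> S))"


section \<open>Internal groupoids\<close>

text \<open>
  \<open>comp G g f\<close> is the composite $g \circ f$, meaningful if \<open>src G g = tgt G f\<close>; \<open>src\<close>, \<open>tgt\<close>,
  \<open>idm\<close> are $d_0$, $d_1$, $\epsilon$.
\<close>

record ('o, 'm, 'u, 'b) int_groupoid =
  Obj :: "('o, 'u, 'b) gwo_alg"
  Mor :: "('m, 'u, 'b) gwo_alg"
  src :: "'m \<Rightarrow> 'o"
  tgt :: "'m \<Rightarrow> 'o"
  idm :: "'o \<Rightarrow> 'm"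
  comp :: "'m \<Rightarrow> 'm \<Rightarrow> 'm"

definition category_on :: "('o, 'm, 'u, 'b) int_groupoid \<Rightarrow> bool" where
  "category_on G \<longleftrightarrow>
     (let C0 = carrier (Obj G); C1 = carrier (Mor G) in
       (\<forall>f \<in> C1. src G f \<in> C0 \<and> tgt G f \<in> C0) \<and>
       (\<forall>x \<in> C0. idm G x \<in> C1 \<and> src G (idm G x) = x \<and> tgt G (idm G x) = x) \<and>
       (\<forall>g \<in> C1. \<forall>f \<in> C1. src G g = tgt G f \<longrightarrow>
          comp G g f \<in> C1 \<and> src G (comp G g f) = src G f \<and> tgt G (comp G g f) = tgt G g) \<and>
       (\<forall>f \<in> C1. comp G f (idm G (src G f)) = f \<and> comp G (idm G (tgt G f)) f = f) \<and>
       (\<forall>h \<in> C1. \<forall>g \<in> C1. \<forall>f \<in> C1. src G h = tgt G g \<longrightarrow> src G g = tgt G f \<longrightarrow>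
          comp G (comp G h g) f = comp G h (comp G g f)))"

definition inverse_mor :: "('o, 'm, 'u, 'b) int_groupoid \<Rightarrow> 'm \<Rightarrow> 'm \<Rightarrow> bool" where
  "inverse_mor G f g \<longleftrightarrow>
     src G g = tgt G f \<and> tgt G g = src G f \<and>
     comp G g f = idm G (src G f) \<and> comp G f g = idm G (tgt G f)"

definition groupoid_on :: "('o, 'm, 'u, 'b) int_groupoid \<Rightarrow> bool" where
  "groupoid_on G \<longleftrightarrow>
     category_on G \<and> (\<forall>f \<in> carrier (Mor G). \<exists>g \<in> carrier (Mor G). inverse_mor G f g)"

text \<open>
  The domain of the partial composition, i.e. the pullback of \<open>src\<close> and \<open>tgt\<close>. That composition is
  a morphism on it amounts to the interchange laws.
\<close>

definition composable_pairs ::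
  "('o, 'm, 'u, 'b) int_groupoid \<Rightarrow> ('m \<times> 'm, 'u, 'b) gwo_alg" where
  "composable_pairs G =
     (let M = Mor G in
      \<lparr>carrier = {(g, f). g \<in> carrier M \<and> f \<in> carrier M \<and> src G g = tgt G f},
       gzero = (gzero M, gzero M),
       gneg = (\<lambda>(g, f). (gneg M g, gneg M f)),
       gadd = (\<lambda>(g, f) (g', f'). (gadd M g g', gadd M f f')),
       gun = (\<lambda>w (g, f). (gun M w g, gun M w f)),
       gbin = (\<lambda>k (g, f) (g', f'). (gbin M k g g', gbin M k f f'))\<rparr>)"

definition internal_groupoid ::
  "('u, 'b) gwo_theory \<Rightarrow> ('o, 'm, 'u, 'b) int_groupoid \<Rightarrow> bool" where
  "internal_groupoid T G \<longleftrightarrow>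
     groupoid_on G \<and>
     gwo_object T (Obj G) \<and> gwo_object T (Mor G) \<and>
     gwo_morphism T (Mor G) (Obj G) (src G) \<and>
     gwo_morphism T (Mor G) (Obj G) (tgt G) \<and>
     gwo_morphism T (Obj G) (Mor G) (idm G) \<and>
     gwo_morphism T (composable_pairs G) (Mor G) (\<lambda>(g, f). comp G g f)"

definition subgroupoid :: "('o, 'm, 'u, 'b) int_groupoid \<Rightarrow> 'm set \<Rightarrow> 'o set \<Rightarrow> bool" where
  "subgroupoid G N1 N0 \<longleftrightarrow>
     N1 \<subseteq> carrier (Mor G) \<and> N0 \<subseteq> carrier (Obj G) \<and>
     (\<forall>f \<in> N1. src G f \<in> N0 \<and> tgt G f \<in> N0) \<and>
     (\<forall>x \<in> N0. idm G x \<in> N1) \<and>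
     (\<forall>g \<in> N1. \<forall>f \<in> N1. src G g = tgt G f \<longrightarrow> comp G g f \<in> N1) \<and>
     (\<forall>f \<in> N1. \<forall>g \<in> carrier (Mor G). inverse_mor G f g \<longrightarrow> g \<in> N1)"

definition internal_normal_subgroupoid ::
  "('u, 'b) gwo_theory \<Rightarrow> ('o, 'm, 'u, 'b) int_groupoid \<Rightarrow> 'm set \<Rightarrow> 'o set \<Rightarrow> bool" where
  "internal_normal_subgroupoid T G N1 N0 \<longleftrightarrow> subgroupoid G N1 N0 \<and> gwo_ideal T N1 (Mor G)"

definition restrict_groupoid ::
  "('o, 'm, 'u, 'b) int_groupoid \<Rightarrow> 'm set \<Rightarrow> 'o set \<Rightarrow> ('o, 'm, 'u, 'b) int_groupoid" where
  "restrict_groupoid G N1 N0 =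
     G\<lparr>Mor := (Mor G)\<lparr>carrier := N1\<rparr>, Obj := (Obj G)\<lparr>carrier := N0\<rparr>\<rparr>"

definition crossed_module_of ::
  "('o, 'm, 'u, 'b) int_groupoid \<Rightarrow> ('m, 'o, 'u, 'b) crossed_mod" where
  "crossed_module_of G =
     \<lparr>cm_top = (Mor G)\<lparr>carrier := gwo_kernel (Mor G) (Obj G) (src G)\<rparr>,
      cm_base = Obj G,
      cm_map = tgt G,
      cm_dot = (\<lambda>b a. gsub (Mor G) (gadd (Mor G) (idm G b) a) (idm G b)),
      cm_star = (\<lambda>f b a. gbin (Mor G) f (idm G b) a)\<rparr>"


section \<open>The middle object of a split extension may live on any type\<close>

lemma gval_closed:
  assumes "closed_under T A N" "gterm_over T t" "range v \<subseteq> N"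
  shows "gval A v t \<in> N"
  using assms by (induction t) (auto simp: closed_under_def)

lemma gwo_object_group:
  assumes T: "groups_with_operations T" and A: "gwo_object T A"
  shows "group (add_group A)" and "\<And>x. x \<in> carrier A \<Longrightarrow> m_inv (add_group A) x = gneg A x"
proof -
  have id: "gval A v l = gval A v r" if "(l, r) \<in> group_laws" "range v \<subseteq> carrier A" for l r v
    using T A that unfolding groups_with_operations_def gwo_object_def by blast
  have cl: "closed_under T A (carrier A)" using A by (simp add: gwo_object_def)
  have assoc: "gadd A (gadd A x y) z = gadd A x (gadd A y z)"
    if "x \<in> carrier A" "y \<in> carrier A" "z \<in> carrier A" for x y z
    using id[of "Add (Add (Var 0) (Var 1)) (Var 2)" "Add (Var 0) (Add (Var 1) (Var 2))"
        "\<lambda>n. if n = 0 then x else if n = 1 then y else z"] that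
    by (auto simp: group_laws_def)
  have zl: "gadd A (gzero A) x = x" if "x \<in> carrier A" for x
    using id[of "Add Zero (Var 0)" "Var 0" "\<lambda>_. x"] that by (auto simp: group_laws_def)
  have nl: "gadd A (gneg A x) x = gzero A" if "x \<in> carrier A" for x
    using id[of "Add (Neg (Var 0)) (Var 0)" "Zero" "\<lambda>_. x"] that by (auto simp: group_laws_def)
  show G: "group (add_group A)"
  proof (rule groupI)
    fix x assume "x \<in> carrier (add_group A)"
    then have "gneg A x \<in> carrier A" "gadd A (gneg A x) x = gzero A"
      using cl nl by (auto simp: closed_under_def add_group_def)
    then show "\<exists>y \<in> carrier (add_group A). y \<otimes>\<^bsub>add_group A\<^esub> x = \<one>\<^bsub>add_group A\<^esub>"
      by (auto simp: add_group_def)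
  qed (use cl assoc zl in \<open>auto simp: add_group_def closed_under_def\<close>)
  show "m_inv (add_group A) x = gneg A x" if "x \<in> carrier A" for x
    using group.inv_equality[OF G, of "gneg A x" x] nl that cl
    by (auto simp: add_group_def closed_under_def)
qed

lemma gwo_object_transport:
  fixes E :: "('e, 'u, 'b) gwo_alg" and \<phi> :: "'e \<Rightarrow> 'd"
  assumes T: "groups_with_operations T" and E: "gwo_object T E"
    and inj: "inj_on \<phi> (carrier E)"
  obtains E' :: "('d, 'u, 'b) gwo_alg" and \<psi> where
    "gwo_object T E'" "carrier E' = \<phi> ` carrier E" "gzero E' = \<phi> (gzero E)"
    "\<And>x. x \<in> carrier E \<Longrightarrow> \<psi> (\<phi> x) = x"
    "\<And>x. x \<in> carrier E \<Longrightarrow> gneg E' (\<phi> x) = \<phi> (gneg E x)"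
    "\<And>x y. x \<in> carrier E \<Longrightarrow> y \<in> carrier E \<Longrightarrow> gadd E' (\<phi> x) (\<phi> y) = \<phi> (gadd E x y)"
    "\<And>w x. x \<in> carrier E \<Longrightarrow> gun E' w (\<phi> x) = \<phi> (gun E w x)"
    "\<And>f x y. x \<in> carrier E \<Longrightarrow> y \<in> carrier E \<Longrightarrow> gbin E' f (\<phi> x) (\<phi> y) = \<phi> (gbin E f x y)"
proof -
  define \<psi> where "\<psi> = inv_into (carrier E) \<phi>"
  have psi: "\<psi> (\<phi> x) = x" if "x \<in> carrier E" for x
    using inj that by (simp add: \<psi>_def)
  define E' :: "('d, 'u, 'b) gwo_alg" where "E' =
    \<lparr>carrier = \<phi> ` carrier E, gzero = \<phi> (gzero E),
     gneg = (\<lambda>x. \<phi> (gneg E (\<psi> x))), gadd = (\<lambda>x y. \<phi> (gadd E (\<psi> x) (\<psi> y))),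
     gun = (\<lambda>w x. \<phi> (gun E w (\<psi> x))), gbin = (\<lambda>f x y. \<phi> (gbin E f (\<psi> x) (\<psi> y)))\<rparr>"
  have cl: "closed_under T E (carrier E)" using E by (simp add: gwo_object_def)
  have cl': "closed_under T E' (carrier E')"
    using cl by (auto simp: closed_under_def E'_def psi)
  have val: "gval E' v t = \<phi> (gval E (\<psi> \<circ> v) t)"
    if "range v \<subseteq> carrier E'" "gterm_over T t" for v t
  proof -
    have r: "range (\<psi> \<circ> v) \<subseteq> carrier E"
    proof
      fix y assume "y \<in> range (\<psi> \<circ> v)"
      then obtain n where n: "y = \<psi> (v n)" by auto
      have "v n \<in> \<phi> ` carrier E" using that(1) by (auto simp: E'_def)
      then show "y \<in> carrier E" using n psi by auto
    qed
    show ?thesis using that(2)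
    proof (induction t)
      case (Var n)
      have "v n \<in> \<phi> ` carrier E" using that(1) by (auto simp: E'_def)
      then show ?case using psi by auto
    qed (simp_all add: E'_def psi gval_closed[OF cl _ r])
  qed
  have "gwo_object T E'"
    unfolding gwo_object_def
  proof (intro conjI cl' ballI, clarify)
    fix l r and v :: "nat \<Rightarrow> 'd"
    assume lr: "(l, r) \<in> Ids T" and v: "range v \<subseteq> carrier E'"
    have w: "gterm_over T l" "gterm_over T r"
      using T lr by (auto simp: groups_with_operations_def)
    have "range (\<psi> \<circ> v) \<subseteq> carrier E"
    proof
      fix y assume "y \<in> range (\<psi> \<circ> v)"
      then obtain n where n: "y = \<psi> (v n)" by auto
      have "v n \<in> \<phi> ` carrier E" using v by (auto simp: E'_def)
      then show "y \<in> carrier E" using n psi by auto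
    qed
    then have "gval E (\<psi> \<circ> v) l = gval E (\<psi> \<circ> v) r"
      using E lr unfolding gwo_object_def by blast
    then show "gval E' v l = gval E' v r" using val[OF v] w by simp
  qed
  then show ?thesis
    by (rule that[of E' \<psi>]) (simp_all add: E'_def psi)
qed

lemma derived_actionsI:
  fixes A :: "('a, 'u, 'b) gwo_alg" and E :: "('e, 'u, 'b) gwo_alg"
    and B :: "('c, 'u, 'b) gwo_alg"
  assumes T: "groups_with_operations T"
    and ext: "split_extension T A E B i p s"
    and act: "actions_from T A E B i s dot star"
  shows "derived_actions T A B dot star"
proof -
  have A: "gwo_object T A" and E: "gwo_object T E" and B: "gwo_object T B"
    and i: "gwo_morphism T A E i" and p: "gwo_morphism T E B p" and s: "gwo_morphism T B E s"
    and inj_i: "inj_on i (carrier A)" and ker: "i ` carrier A = gwo_kernel E B p"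
    and surj: "p ` carrier E = carrier B" and ps: "\<And>b. b \<in> carrier B \<Longrightarrow> p (s b) = b"
    using ext unfolding split_extension_def by auto
  interpret GE: group "add_group E" using gwo_object_group[OF T E] by simp
  have cE: "closed_under T E (carrier E)" using E by (simp add: gwo_object_def)
  have iE: "i a \<in> carrier E" if "a \<in> carrier A" for a
    using i that by (auto simp: gwo_morphism_def hom_def add_group_def)
  have pB: "p x \<in> carrier B" if "x \<in> carrier E" for x
    using p that by (auto simp: gwo_morphism_def hom_def add_group_def)
  have sE: "s b \<in> carrier E" if "b \<in> carrier B" for b
    using s that by (auto simp: gwo_morphism_def hom_def add_group_def)
  interpret pg: group_hom "add_group E" "add_group B" p
    using gwo_object_group[OF T E] gwo_object_group[OF T B] p
    by (simp add: group_hom_def group_hom_axioms_def gwo_morphism_def)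
  have neg_eq: "gneg E x = m_inv (add_group E) x" if "x \<in> carrier E" for x
    using gwo_object_group(2)[OF T E that] by simp
  have diff: "gsub E x (s (p x)) \<in> i ` carrier A" if x: "x \<in> carrier E" for x
  proof -
    have s': "s (p x) \<in> carrier (add_group E)" and x': "x \<in> carrier (add_group E)"
      using sE pB x by (auto simp: add_group_def)
    have "p (mult (add_group E) x (m_inv (add_group E) (s (p x)))) =
          mult (add_group B) (p x) (m_inv (add_group B) (p x))"
      using s' x' ps[OF pB[OF x]] by simp
    also have "\<dots> = one (add_group B)" using x' pg.hom_closed by (simp add: pg.H.r_inv)
    finally have "p (gsub E x (s (p x))) = one (add_group B)"
      using neg_eq sE pB x by (simp add: gsub_def add_group_def)
    moreover have "gsub E x (s (p x)) \<in> carrier E"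
      using cE x sE pB by (auto simp: gsub_def closed_under_def)
    ultimately show ?thesis
      by (simp add: ker gwo_kernel_def kernel_def) (simp add: add_group_def)
  qed
  define \<phi> where "\<phi> x = (inv_into (carrier A) i (gsub E x (s (p x))), p x)" for x
  have inj: "inj_on \<phi> (carrier E)"
  proof (rule inj_onI)
    fix x y assume x: "x \<in> carrier E" and y: "y \<in> carrier E" and e: "\<phi> x = \<phi> y"
    have pe: "p x = p y" using e by (simp add: \<phi>_def)
    have "gsub E x (s (p x)) = gsub E y (s (p y))"
      using e f_inv_into_f[OF diff[OF x]] f_inv_into_f[OF diff[OF y]]
      unfolding \<phi>_def prod.inject by metis
    then have "gadd E x (gneg E (s (p x))) = gadd E y (gneg E (s (p x)))"
      using pe by (simp add: gsub_def)
    moreover have "gneg E (s (p x)) \<in> carrier E"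
      using cE sE pB x by (auto simp: closed_under_def)
    ultimately show "x = y"
      using x y GE.right_cancel by (simp add: add_group_def)
  qed
  obtain E' :: "('a \<times> 'c, 'u, 'b) gwo_alg" and \<psi> where
    E': "gwo_object T E'" and car: "carrier E' = \<phi> ` carrier E"
    and z: "gzero E' = \<phi> (gzero E)"
    and psi: "\<And>x. x \<in> carrier E \<Longrightarrow> \<psi> (\<phi> x) = x"
    and ops: "\<And>x. x \<in> carrier E \<Longrightarrow> gneg E' (\<phi> x) = \<phi> (gneg E x)"
    "\<And>x y. x \<in> carrier E \<Longrightarrow> y \<in> carrier E \<Longrightarrow> gadd E' (\<phi> x) (\<phi> y) = \<phi> (gadd E x y)"
    "\<And>w x. x \<in> carrier E \<Longrightarrow> gun E' w (\<phi> x) = \<phi> (gun E w x)"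
    "\<And>f x y. x \<in> carrier E \<Longrightarrow> y \<in> carrier E \<Longrightarrow> gbin E' f (\<phi> x) (\<phi> y) = \<phi> (gbin E f x y)"
    by (rule gwo_object_transport[OF T E inj]) (rule that, assumption+)
  note clE = cE[unfolded closed_under_def]
  have "gwo_morphism T A E' (\<phi> \<circ> i)"
    using i iE by (auto simp: gwo_morphism_def hom_def add_group_def car ops)
  moreover have "gwo_morphism T E' B (p \<circ> \<psi>)"
    using p pB clE by (auto simp: gwo_morphism_def hom_def add_group_def car ops psi)
  moreover have "gwo_morphism T B E' (\<phi> \<circ> s)"
    using s sE by (auto simp: gwo_morphism_def hom_def add_group_def car ops)
  moreover have "inj_on (\<phi> \<circ> i) (carrier A)"
    using inj_i inj iE by (auto intro!: comp_inj_on elim: inj_on_subset)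
  moreover have "(\<phi> \<circ> i) ` carrier A = gwo_kernel E' B (p \<circ> \<psi>)"
  proof -
    have "(\<phi> \<circ> i) ` carrier A = \<phi> ` gwo_kernel E B p" by (simp add: ker[symmetric] image_image)
    also have "\<dots> = gwo_kernel E' B (p \<circ> \<psi>)"
      by (auto simp: gwo_kernel_def kernel_def add_group_def car psi)
    finally show ?thesis .
  qed
  moreover have "(p \<circ> \<psi>) ` carrier E' = carrier B"
    using surj by (auto simp: car psi image_image)
  moreover have "\<forall>b \<in> carrier B. (p \<circ> \<psi>) ((\<phi> \<circ> s) b) = b"
    using ps sE psi by simp
  ultimately have "split_extension T A E' B (\<phi> \<circ> i) (p \<circ> \<psi>) (\<phi> \<circ> s)"
    using A B E' by (simp add: split_extension_def)
  moreover have "actions_from T A E' B (\<phi> \<circ> i) (\<phi> \<circ> s) dot star"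
    using act iE sE clE by (auto simp: actions_from_def gsub_def ops)
  ultimately show ?thesis unfolding derived_actions_def by blast
qed

end

theory Submission
  imports Defs
begin

text \<open>
  For an internal groupoid $G$, the kernel $K$ of $d_0$ sits in the split extension
  $K \to G_1 \to G_0$ with section $\epsilon$, and the actions of $G_0$ on $K$ are the ones derived
  from it (lemma \<open>derived_actions_kernel\<close>). The equivariance of $d_1$ holds because $d_1$ is a
  morphism with $d_1 \epsilon = \mathrm{id}$. The two Peiffer identities come from the remaining
  datum, that composition is a morphism: an arrow $h$ with target $0$ and an arrow $a$ with source
  $0$ can be composed with the identity of $0$ in complementary positions, and the interchange law
  then gives $a + h = h + a$ and $h \star a = 0$ (lemmas \<open>zero_source_add_commute\<close> and
  \<open>zero_target_bin_zero_source\<close>). For any arrow $a$, both $-a + 1_{d_1 a}$ and $1_{d_1 a} - a$ have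
  target $0$, so in acting on arrows with source $0$ the identity $1_{d_1 a}$ may be replaced by $a$.

  A normal subgroupoid $N$ is closed under everything involved, hence is an internal groupoid in its
  own right, and the construction just described applies to it; its kernel is $N_1 \cap K$ and its
  actions are restrictions. The normality conditions then say that certain elements lie both in $K$
  and in the ideal $N_1$. Membership in $K$ is seen by applying $d_0$. Membership in $N_1$ holds
  because each element is a conjugate, a commutator or a product in $G_1$ with one entry in
  $N_1$, namely $s$ itself or $1_t$. Finally, $N_0$ is an ideal because it is the image of
  $N_1$ under the surjective morphism $d_0$.
\<close>

section \<open>Calculus in a group with operations\<close>

locale gwo =
  fixes T :: "('u, 'b) gwo_theory" and A :: "('a, 'u, 'b) gwo_alg"
  assumes theory_gwo: "groups_with_operations T" and object: "gwo_object T A"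
begin

sublocale add: group "add_group A"
  rewrites "carrier (add_group A) = carrier A"
    and "mult (add_group A) = gadd A"
    and "one (add_group A) = gzero A"
  using gwo_object_group(1)[OF theory_gwo object] by (simp_all add: add_group_def)

lemma add_inv_eq: "x \<in> carrier A \<Longrightarrow> m_inv (add_group A) x = gneg A x"
  using gwo_object_group(2)[OF theory_gwo object] .

lemma closed: "closed_under T A (carrier A)"
  using object by (simp add: gwo_object_def)

lemma neg_closed [simp]: "x \<in> carrier A \<Longrightarrow> gneg A x \<in> carrier A"
  and add_closed [simp]: "x \<in> carrier A \<Longrightarrow> y \<in> carrier A \<Longrightarrow> gadd A x y \<in> carrier A"
  and sub_closed [simp]: "x \<in> carrier A \<Longrightarrow> y \<in> carrier A \<Longrightarrow> gsub A x y \<in> carrier A"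
  and zero_closed [simp]: "gzero A \<in> carrier A"
  and un_closed [simp]: "w \<in> Om1 T \<Longrightarrow> x \<in> carrier A \<Longrightarrow> gun A w x \<in> carrier A"
  and bin_closed [simp]:
    "f \<in> Om2 T \<Longrightarrow> x \<in> carrier A \<Longrightarrow> y \<in> carrier A \<Longrightarrow> gbin A f x y \<in> carrier A"
  using closed by (auto simp: closed_under_def gsub_def)

lemma add_neg [simp]: "x \<in> carrier A \<Longrightarrow> gadd A x (gneg A x) = gzero A"
  and neg_add [simp]: "x \<in> carrier A \<Longrightarrow> gadd A (gneg A x) x = gzero A"
  and neg_zero [simp]: "gneg A (gzero A) = gzero A"
  using add.r_inv[of x] add.l_inv[of x] add_inv_eq[of x] add.inv_one add_inv_eq[of "gzero A"]
  by auto

lemma identity: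
  "(l, r) \<in> Ids T \<Longrightarrow> range v \<subseteq> carrier A \<Longrightarrow> gval A v l = gval A v r"
  using object unfolding gwo_object_def by blast

lemma opp_closed: "f \<in> Om2 T \<Longrightarrow> opp T f \<in> Om2 T"
  using theory_gwo by (auto simp: groups_with_operations_def)

lemma bin_opp:
  assumes "f \<in> Om2 T" "x \<in> carrier A" "y \<in> carrier A"
  shows "gbin A (opp T f) x y = gbin A f y x"
  using identity[of "BinOp (opp T f) (Var 0) (Var 1)" "BinOp f (Var 1) (Var 0)"
      "\<lambda>n. if n = 0 then x else y"] theory_gwo assms
  by (auto simp: groups_with_operations_def)

lemma bin_add_right:
  assumes "f \<in> Om2 T" "x \<in> carrier A" "y \<in> carrier A" "z \<in> carrier A"
  shows "gbin A f x (gadd A y z) = gadd A (gbin A f x y) (gbin A f x z)"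
  using identity[of "BinOp f (Var 0) (Add (Var 1) (Var 2))"
      "Add (BinOp f (Var 0) (Var 1)) (BinOp f (Var 0) (Var 2))"
      "\<lambda>n. if n = 0 then x else if n = 1 then y else z"] theory_gwo assms
  by (auto simp: groups_with_operations_def)

text \<open>
  Distributivity is postulated in the second argument only; in the first it is distributivity of
  the opposite operation.
\<close>

lemma bin_add_left:
  assumes "f \<in> Om2 T" "x \<in> carrier A" "y \<in> carrier A" "z \<in> carrier A"
  shows "gbin A f (gadd A x y) z = gadd A (gbin A f x z) (gbin A f y z)"
  using bin_add_right[OF opp_closed[OF assms(1)] assms(4,2,3)] assms by (simp add: bin_opp)

lemma un_add:
  assumes "w \<in> Om1 T" "x \<in> carrier A" "y \<in> carrier A"
  shows "gun A w (gadd A x y) = gadd A (gun A w x) (gun A w y)"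
  using identity[of "UnOp w (Add (Var 0) (Var 1))" "Add (UnOp w (Var 0)) (UnOp w (Var 1))"
      "\<lambda>n. if n = 0 then x else y"] theory_gwo assms
  by (auto simp: groups_with_operations_def)

lemma un_zero [simp]:
  assumes "w \<in> Om1 T"
  shows "gun A w (gzero A) = gzero A"
  using un_add[OF assms zero_closed zero_closed] assms by simp

lemma bin_zero_right [simp]:
  assumes "f \<in> Om2 T" "x \<in> carrier A"
  shows "gbin A f x (gzero A) = gzero A"
  using bin_add_right[OF assms zero_closed zero_closed] assms by simp

lemma bin_zero_left [simp]:
  assumes "f \<in> Om2 T" "x \<in> carrier A"
  shows "gbin A f (gzero A) x = gzero A"
  using bin_add_left[OF assms(1) zero_closed zero_closed assms(2)] assms by simp

end

lemma gval_carrier_update: "gval (A\<lparr>carrier := N\<rparr>) v t = gval A v t"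
  by (induction t) simp_all

lemma closed_under_carrier_update: "closed_under T (A\<lparr>carrier := N\<rparr>) S = closed_under T A S"
  by (simp add: closed_under_def)

lemma subalgebra_iff_subobject: "subalgebra T (A\<lparr>carrier := N\<rparr>) A \<longleftrightarrow> subobject T N A"
  by (auto simp: subalgebra_def)

context gwo
begin

lemma subobject_is_object:
  assumes "subobject T N A"
  shows "gwo_object T (A\<lparr>carrier := N\<rparr>)"
  using assms object
  unfolding gwo_object_def subobject_def
  by (auto simp: gval_carrier_update closed_under_carrier_update)

lemma subobject_subgroup:
  assumes "subobject T N A"
  shows "subgroup N (add_group A)"
  using assms unfolding subobject_def closed_under_def
  by (intro add.subgroupI) (auto simp: add_inv_eq subsetD)

lemma ideal_iff:
  "gwo_ideal T N A \<longleftrightarrow>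
     subobject T N A \<and>
     (\<forall>a \<in> carrier A. \<forall>n \<in> N. gsub A (gadd A a n) a \<in> N) \<and>
     (\<forall>f \<in> Om2 T. \<forall>a \<in> carrier A. \<forall>n \<in> N. gbin A f a n \<in> N)"
  using subobject_subgroup
  by (auto simp: gwo_ideal_def add.normal_inv_iff gsub_def add_inv_eq)

end

section \<open>Morphisms, kernels and images\<close>

lemma morphism_restrict:
  assumes h: "gwo_morphism T A B h" and S: "S \<subseteq> carrier A" and R: "h ` S \<subseteq> R"
  shows "gwo_morphism T (A\<lparr>carrier := S\<rparr>) (B\<lparr>carrier := R\<rparr>) h"
proof -
  have mem: "x \<in> carrier A" "h x \<in> R" if "x \<in> S" for x using that S R by auto
  show ?thesis using h mem by (simp add: gwo_morphism_def hom_def add_group_def Pi_iff)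
qed

locale gwo_hom = A: gwo T A + B: gwo T B
  for T :: "('u, 'b) gwo_theory" and A :: "('a, 'u, 'b) gwo_alg" and B :: "('c, 'u, 'b) gwo_alg" +
  fixes h :: "'a \<Rightarrow> 'c"
  assumes morphism: "gwo_morphism T A B h"
begin

lemma map_closed [simp]: "x \<in> carrier A \<Longrightarrow> h x \<in> carrier B"
  and map_add [simp]: "x \<in> carrier A \<Longrightarrow> y \<in> carrier A \<Longrightarrow> h (gadd A x y) = gadd B (h x) (h y)"
  and map_un [simp]: "w \<in> Om1 T \<Longrightarrow> x \<in> carrier A \<Longrightarrow> h (gun A w x) = gun B w (h x)"
  and map_bin [simp]: "f \<in> Om2 T \<Longrightarrow> x \<in> carrier A \<Longrightarrow> y \<in> carrier A
    \<Longrightarrow> h (gbin A f x y) = gbin B f (h x) (h y)"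
  using morphism by (auto simp: gwo_morphism_def hom_def add_group_def)

lemma map_zero [simp]: "h (gzero A) = gzero B"
  using map_add[of "gzero A" "gzero A"] B.add.r_cancel_one by simp

lemma map_neg [simp]: "x \<in> carrier A \<Longrightarrow> h (gneg A x) = gneg B (h x)"
  using map_add[of "gneg A x" x] B.add.inv_equality[of "h (gneg A x)" "h x"] B.add_inv_eq
  by simp

lemma map_sub [simp]:
  "x \<in> carrier A \<Longrightarrow> y \<in> carrier A \<Longrightarrow> h (gsub A x y) = gsub B (h x) (h y)"
  by (simp add: gsub_def)

lemma mem_kernel_iff: "x \<in> gwo_kernel A B h \<longleftrightarrow> x \<in> carrier A \<and> h x = gzero B"
  by (simp add: gwo_kernel_def kernel_def add_group_def)

lemma kernel_subobject: "subobject T (gwo_kernel A B h) A"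
  by (auto simp: subobject_def closed_under_def mem_kernel_iff)

text \<open>
  Surjectivity provides, for each element of \<open>B\<close> acting on the image, a preimage in \<open>A\<close> that acts
  on \<open>N\<close>.
\<close>

lemma image_ideal:
  assumes surj: "h ` carrier A = carrier B" and N: "gwo_ideal T N A"
  shows "gwo_ideal T (h ` N) B"
proof -
  have sub: "N \<subseteq> carrier A" and cl: "closed_under T A N"
    and conj: "\<And>a n. a \<in> carrier A \<Longrightarrow> n \<in> N \<Longrightarrow> gsub A (gadd A a n) a \<in> N"
    and bin: "\<And>f a n. f \<in> Om2 T \<Longrightarrow> a \<in> carrier A \<Longrightarrow> n \<in> N \<Longrightarrow> gbin A f a n \<in> N"
    using N by (auto simp: A.ideal_iff subobject_def)
  have mem: "n \<in> carrier A" if "n \<in> N" for n using sub that by auto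
  have "subobject T (h ` N) B"
    unfolding subobject_def closed_under_def
  proof (intro conjI ballI subsetI)
    show "gzero B \<in> h ` N"
      using cl map_zero by (force simp: closed_under_def)
  qed (use cl mem in \<open>auto simp: closed_under_def simp flip: map_neg map_add map_un map_bin\<close>)
  moreover have "gsub B (gadd B b m) b \<in> h ` N" if b: "b \<in> carrier B" and m: "m \<in> h ` N" for b m
  proof -
    obtain a n where "a \<in> carrier A" "b = h a" "n \<in> N" "m = h n" using surj b m by blast
    then show ?thesis using conj[of a n] mem by (auto simp flip: map_add map_sub)
  qed
  moreover have "gbin B f b m \<in> h ` N"
    if f: "f \<in> Om2 T" and b: "b \<in> carrier B" and m: "m \<in> h ` N" for f b m
  proof -
    obtain a n where "a \<in> carrier A" "b = h a" "n \<in> N" "m = h n" using surj b m by blast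
    then show ?thesis using bin[OF f, of a n] f mem by (auto simp flip: map_bin)
  qed
  ultimately show ?thesis by (simp add: B.ideal_iff)
qed

end

section \<open>The crossed module of an internal groupoid\<close>

locale internal_gpd =
  fixes T :: "('u, 'b) gwo_theory" and G :: "('o, 'm, 'u, 'b) int_groupoid"
  assumes theory_gwo: "groups_with_operations T" and internal: "internal_groupoid T G"
begin

sublocale M: gwo T "Mor G" + O: gwo T "Obj G"
  using theory_gwo internal by (auto simp: gwo_def internal_groupoid_def)

sublocale src: gwo_hom T "Mor G" "Obj G" "src G"
  + tgt: gwo_hom T "Mor G" "Obj G" "tgt G"
  + idm: gwo_hom T "Obj G" "Mor G" "idm G"
  using internal by unfold_locales (auto simp: internal_groupoid_def)

lemma category: "category_on G"
  using internal by (simp add: internal_groupoid_def groupoid_on_def)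

lemma src_idm [simp]: "x \<in> carrier (Obj G) \<Longrightarrow> src G (idm G x) = x"
  and tgt_idm [simp]: "x \<in> carrier (Obj G) \<Longrightarrow> tgt G (idm G x) = x"
  and comp_idm_src: "f \<in> carrier (Mor G) \<Longrightarrow> comp G f (idm G (src G f)) = f"
  and comp_idm_tgt: "f \<in> carrier (Mor G) \<Longrightarrow> comp G (idm G (tgt G f)) f = f"
  using category unfolding category_on_def Let_def by auto

lemma comp_zero_right:
  "g \<in> carrier (Mor G) \<Longrightarrow> src G g = gzero (Obj G) \<Longrightarrow> comp G g (gzero (Mor G)) = g"
  using comp_idm_src[of g] by simp

lemma comp_zero_left:
  "f \<in> carrier (Mor G) \<Longrightarrow> tgt G f = gzero (Obj G) \<Longrightarrow> comp G (gzero (Mor G)) f = f"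
  using comp_idm_tgt[of f] by simp

lemma interchange_add:
  assumes "g \<in> carrier (Mor G)" "f \<in> carrier (Mor G)" "src G g = tgt G f"
    and "g' \<in> carrier (Mor G)" "f' \<in> carrier (Mor G)" "src G g' = tgt G f'"
  shows "comp G (gadd (Mor G) g g') (gadd (Mor G) f f') =
    gadd (Mor G) (comp G g f) (comp G g' f')"
proof -
  have "(\<lambda>(g, f). comp G g f) \<in> hom (add_group (composable_pairs G)) (add_group (Mor G))"
    using internal by (simp add: internal_groupoid_def gwo_morphism_def)
  from hom_mult[OF this, of "(g, f)" "(g', f')"] assms show ?thesis
    by (simp add: add_group_def composable_pairs_def Let_def)
qed

lemma interchange_bin:
  assumes "k \<in> Om2 T"
    and "g \<in> carrier (Mor G)" "f \<in> carrier (Mor G)" "src G g = tgt G f"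
    and "g' \<in> carrier (Mor G)" "f' \<in> carrier (Mor G)" "src G g' = tgt G f'"
  shows "comp G (gbin (Mor G) k g g') (gbin (Mor G) k f f') =
    gbin (Mor G) k (comp G g f) (comp G g' f')"
proof -
  have c: "(g, f) \<in> carrier (composable_pairs G)" "(g', f') \<in> carrier (composable_pairs G)"
    using assms by (simp_all add: composable_pairs_def Let_def)
  have "\<forall>x \<in> carrier (composable_pairs G). \<forall>y \<in> carrier (composable_pairs G).
      (\<lambda>(g, f). comp G g f) (gbin (composable_pairs G) k x y) =
      gbin (Mor G) k ((\<lambda>(g, f). comp G g f) x) ((\<lambda>(g, f). comp G g f) y)"
    using internal assms(1) by (simp add: internal_groupoid_def gwo_morphism_def)
  from this[rule_format, OF c] show ?thesis
    by (simp add: composable_pairs_def Let_def)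
qed

text \<open>
  An Eckmann--Hilton argument: the pairs $(a, 0)$ and $(0, h)$ are composable, composition sends
  them to $a$ and $h$, and their sum in either order is $(a, h)$.
\<close>

lemma zero_source_add_commute:
  assumes "a \<in> carrier (Mor G)" "src G a = gzero (Obj G)"
    and "h \<in> carrier (Mor G)" "tgt G h = gzero (Obj G)"
  shows "gadd (Mor G) a h = gadd (Mor G) h a"
  using interchange_add[of a "gzero (Mor G)" "gzero (Mor G)" h]
    interchange_add[of "gzero (Mor G)" h a "gzero (Mor G)"] assms
  by (simp add: comp_zero_left comp_zero_right)

text \<open>
  The same two pairs, multiplied componentwise, give $(0 \star a, h \star 0) = (0, 0)$, and
  composition sends this product both to $h \star a$ and to $0$.
\<close>

lemma zero_target_bin_zero_source:
  assumes "k \<in> Om2 T"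
    and "h \<in> carrier (Mor G)" "tgt G h = gzero (Obj G)"
    and "a \<in> carrier (Mor G)" "src G a = gzero (Obj G)"
  shows "gbin (Mor G) k h a = gzero (Mor G)"
  using interchange_bin[of k "gzero (Mor G)" h a "gzero (Mor G)"] assms
  by (simp add: comp_zero_left comp_zero_right)

text \<open>
  Write $1_{d_1 a} = a + h$. Then $h$ has target $0$, so it commutes with $a'$ and contributes
  nothing to the conjugate.
\<close>

lemma peiffer_conjugation:
  assumes a: "a \<in> carrier (Mor G)"
    and a': "a' \<in> carrier (Mor G)" "src G a' = gzero (Obj G)"
  shows "gsub (Mor G) (gadd (Mor G) (idm G (tgt G a)) a') (idm G (tgt G a)) =
    gsub (Mor G) (gadd (Mor G) a a') a"
proof -
  let ?e = "idm G (tgt G a)" and ?p = "gadd (Mor G)" and ?n = "gneg (Mor G)"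
  let ?h = "?p (?n a) ?e"
  have e: "?e \<in> carrier (Mor G)" using a by simp
  have e_eq: "?e = ?p a ?h" using a e by (simp flip: M.add.m_assoc)
  have "?p ?h a' = ?p a' ?h"
    using zero_source_add_commute[of a' ?h] a a' e by simp
  then have "?p ?e a' = ?p (?p a a') ?h"
    using a a' e by (subst e_eq) (simp add: M.add.m_assoc)
  also have "\<dots> = ?p (?p (?p a a') (?n a)) ?e"
    using a a' e by (simp add: M.add.m_assoc)
  finally show ?thesis using a a' e by (simp add: gsub_def M.add.m_assoc)
qed

text \<open>
  Write $1_{d_1 a} = h + a$. Then $h$ has target $0$, so $h \star a' = 0$.
\<close>

lemma peiffer_bin:
  assumes k: "k \<in> Om2 T" and a: "a \<in> carrier (Mor G)"
    and a': "a' \<in> carrier (Mor G)" "src G a' = gzero (Obj G)"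
  shows "gbin (Mor G) k (idm G (tgt G a)) a' = gbin (Mor G) k a a'"
proof -
  let ?e = "idm G (tgt G a)"
  let ?h = "gsub (Mor G) ?e a"
  have e: "?e \<in> carrier (Mor G)" using a by simp
  have "?e = gadd (Mor G) ?h a" using a e by (simp add: gsub_def M.add.m_assoc)
  then have "gbin (Mor G) k ?e a' = gadd (Mor G) (gbin (Mor G) k ?h a') (gbin (Mor G) k a a')"
    using k a a' e M.bin_add_left[of k ?h a a'] by simp
  also have "gbin (Mor G) k ?h a' = gzero (Mor G)"
    using k a a' e by (intro zero_target_bin_zero_source) (simp_all add: gsub_def)
  finally show ?thesis using k a a' by simp
qed

lemma dot_closed:
  assumes "b \<in> carrier (Obj G)" "a \<in> gwo_kernel (Mor G) (Obj G) (src G)"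
  shows "gsub (Mor G) (gadd (Mor G) (idm G b) a) (idm G b) \<in> gwo_kernel (Mor G) (Obj G) (src G)"
  using assms by (simp add: src.mem_kernel_iff) (simp add: gsub_def)

lemma star_closed:
  assumes "f \<in> Om2 T" "b \<in> carrier (Obj G)" "a \<in> gwo_kernel (Mor G) (Obj G) (src G)"
  shows "gbin (Mor G) f (idm G b) a \<in> gwo_kernel (Mor G) (Obj G) (src G)"
  using assms by (simp add: src.mem_kernel_iff)

text \<open>
  The split extension is $\ker d_0 \to G_1 \to G_0$ with section $\epsilon$; it is the reason for
  the formulas defining the two actions.
\<close>

lemma derived_actions_kernel:
  "derived_actions T ((Mor G)\<lparr>carrier := gwo_kernel (Mor G) (Obj G) (src G)\<rparr>) (Obj G)
     (\<lambda>b a. gsub (Mor G) (gadd (Mor G) (idm G b) a) (idm G b))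
     (\<lambda>f b a. gbin (Mor G) f (idm G b) a)"
    (is "derived_actions T ?K _ ?dot ?star")
proof (rule derived_actionsI[OF theory_gwo])
  have "gwo_morphism T ?K (Mor G) (\<lambda>x. x)"
    by (auto simp: gwo_morphism_def hom_def add_group_def src.mem_kernel_iff)
  moreover have "src G ` carrier (Mor G) = carrier (Obj G)"
    by (force simp: image_iff intro: src_idm[symmetric])
  ultimately show "split_extension T ?K (Mor G) (Obj G) (\<lambda>x. x) (src G) (idm G)"
    by (simp add: split_extension_def M.subobject_is_object src.kernel_subobject M.object O.object
        src.morphism idm.morphism)
  show "actions_from T ?K (Mor G) (Obj G) (\<lambda>x. x) (idm G) ?dot ?star"
    by (simp add: actions_from_def dot_closed star_closed)
qed

lemma crossed_module_of_groupoid: "crossed_module T (crossed_module_of G)"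
proof -
  let ?K = "gwo_kernel (Mor G) (Obj G) (src G)"
  have "gwo_morphism T ((Mor G)\<lparr>carrier := ?K\<rparr>) (Obj G) (tgt G)"
  proof -
    have "?K \<subseteq> carrier (Mor G)" "tgt G ` ?K \<subseteq> carrier (Obj G)"
      by (auto simp: src.mem_kernel_iff)
    from morphism_restrict[OF tgt.morphism this] show ?thesis by simp
  qed
  moreover have "gbin (Mor G) (opp T f) (idm G b) a = gbin (Mor G) f a (idm G b)"
    if "f \<in> Om2 T" "b \<in> carrier (Obj G)" "a \<in> carrier (Mor G)" for f b a
    using that by (simp add: M.bin_opp)
  ultimately show ?thesis
    unfolding crossed_module_def crossed_module_of_def Let_def
    using peiffer_conjugation peiffer_bin
    by (simp add: M.subobject_is_object src.kernel_subobject O.object derived_actions_kernel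
        src.mem_kernel_iff) (simp add: gsub_def)
qed

end

section \<open>Normal subgroupoids\<close>

locale normal_subgpd = internal_gpd T G
  for T :: "('u, 'b) gwo_theory" and G :: "('o, 'm, 'u, 'b) int_groupoid" +
  fixes N1 :: "'m set" and N0 :: "'o set"
  assumes normal_sub: "internal_normal_subgroupoid T G N1 N0"
begin

lemma ideal_N1: "gwo_ideal T N1 (Mor G)" and subgpd: "subgroupoid G N1 N0"
  using normal_sub by (auto simp: internal_normal_subgroupoid_def)

lemma N1_subset: "N1 \<subseteq> carrier (Mor G)" and N0_subset: "N0 \<subseteq> carrier (Obj G)"
  and src_N1: "f \<in> N1 \<Longrightarrow> src G f \<in> N0" and tgt_N1: "f \<in> N1 \<Longrightarrow> tgt G f \<in> N0"
  and idm_N0: "x \<in> N0 \<Longrightarrow> idm G x \<in> N1"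
  using subgpd by (auto simp: subgroupoid_def)

lemma subobject_N1: "subobject T N1 (Mor G)"
  using ideal_N1 by (simp add: gwo_ideal_def)

text \<open>
  Each object $x$ in \<open>N0\<close> is the source of the arrow $1_x$, so the ideal property of \<open>N0\<close> can be
  deduced from that of \<open>N1\<close>.
\<close>

lemma N0_eq_src_image: "N0 = src G ` N1"
proof
  show "N0 \<subseteq> src G ` N1"
  proof
    fix x assume x: "x \<in> N0"
    then have "src G (idm G x) = x" using N0_subset by auto
    then show "x \<in> src G ` N1" using idm_N0[OF x] by (metis imageI)
  qed
qed (use src_N1 in auto)

lemma ideal_N0: "gwo_ideal T N0 (Obj G)"
proof -
  have "src G ` carrier (Mor G) = carrier (Obj G)"
    by (force simp: image_iff intro: src_idm[symmetric])
  then show ?thesis using src.image_ideal ideal_N1 by (simp add: N0_eq_src_image)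
qed

lemma subobject_N0: "subobject T N0 (Obj G)"
  using ideal_N0 by (simp add: gwo_ideal_def)

lemma groupoid_restrict: "groupoid_on (restrict_groupoid G N1 N0)"
proof -
  have N1: "f \<in> carrier (Mor G)" if "f \<in> N1" for f using that N1_subset by auto
  have N0: "x \<in> carrier (Obj G)" if "x \<in> N0" for x using that N0_subset by auto
  have comp_N1: "comp G g f \<in> N1" if "g \<in> N1" "f \<in> N1" "src G g = tgt G f" for g f
    using subgpd that by (simp add: subgroupoid_def)
  note cat = category[unfolded category_on_def Let_def]
  have "category_on (restrict_groupoid G N1 N0)"
    unfolding category_on_def restrict_groupoid_def Let_def
  proof (simp, intro conjI ballI impI)
    fix h g f
    assume "h \<in> N1" "g \<in> N1" "f \<in> N1" "src G h = tgt G g" "src G g = tgt G f"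
    then show "comp G (comp G h g) f = comp G h (comp G g f)" using cat N1 by blast
  next
    fix g f
    assume "g \<in> N1" "f \<in> N1" "src G g = tgt G f"
    then show "comp G g f \<in> N1" "src G (comp G g f) = src G f" "tgt G (comp G g f) = tgt G g"
      using cat N1 comp_N1 by blast+
  qed (use N1 N0 src_N1 tgt_N1 idm_N0 comp_idm_src comp_idm_tgt in simp_all)
  moreover have "\<exists>g \<in> N1. inverse_mor G f g" if f: "f \<in> N1" for f
  proof -
    obtain g where g: "g \<in> carrier (Mor G)" "inverse_mor G f g"
      using internal N1[OF f] unfolding internal_groupoid_def groupoid_on_def by blast
    then have "g \<in> N1" using subgpd f unfolding subgroupoid_def by blast
    with g show ?thesis by blast
  qed
  ultimately show ?thesis
    by (simp add: groupoid_on_def restrict_groupoid_def inverse_mor_def)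
qed

text \<open>
  Once \<open>N\<close> is known to be an internal groupoid, its crossed module axioms need no argument of
  their own.
\<close>

lemma internal_groupoid_restrict: "internal_groupoid T (restrict_groupoid G N1 N0)"
proof -
  let ?H = "restrict_groupoid G N1 N0"
  have "gwo_morphism T (composable_pairs ?H) (Mor ?H) (\<lambda>(g, f). comp ?H g f)"
  proof -
    let ?P = "composable_pairs G"
    \<comment> \<open>The operations on pairs agree, so this is a restriction of the composition morphism of \<open>G\<close>.\<close>
    have pairs: "composable_pairs ?H = ?P\<lparr>carrier := carrier (composable_pairs ?H)\<rparr>"
      by (simp add: composable_pairs_def restrict_groupoid_def Let_def)
    have sub: "carrier (composable_pairs ?H) \<subseteq> carrier ?P"
      using N1_subset by (auto simp: composable_pairs_def restrict_groupoid_def Let_def)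
    have comp: "(\<lambda>(g, f). comp G g f) ` carrier (composable_pairs ?H) \<subseteq> N1"
      using subgpd
      by (auto simp: composable_pairs_def restrict_groupoid_def subgroupoid_def Let_def)
    have "gwo_morphism T ?P (Mor G) (\<lambda>(g, f). comp G g f)"
      using internal by (simp add: internal_groupoid_def)
    from morphism_restrict[OF this sub comp]
    show ?thesis by (subst pairs) (simp add: restrict_groupoid_def)
  qed
  moreover have "src G ` N1 \<subseteq> N0" "tgt G ` N1 \<subseteq> N0" "idm G ` N0 \<subseteq> N1"
    using src_N1 tgt_N1 idm_N0 by auto
  ultimately show ?thesis
    using groupoid_restrict N1_subset N0_subset morphism_restrict[OF src.morphism]
      morphism_restrict[OF tgt.morphism] morphism_restrict[OF idm.morphism] M.subobject_is_object[OF subobject_N1]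
      O.subobject_is_object[OF subobject_N0]
    by (simp add: internal_groupoid_def restrict_groupoid_def)
qed

lemma kernel_restrict:
  "gwo_kernel ((Mor G)\<lparr>carrier := N1\<rparr>) ((Obj G)\<lparr>carrier := N0\<rparr>) (src G) =
     N1 \<inter> gwo_kernel (Mor G) (Obj G) (src G)"
  using N1_subset by (auto simp: gwo_kernel_def kernel_def add_group_def)

lemma subcrossed_module_restrict:
  "subcrossed_module T (crossed_module_of (restrict_groupoid G N1 N0)) (crossed_module_of G)"
proof -
  interpret N: internal_gpd T "restrict_groupoid G N1 N0"
    using theory_gwo internal_groupoid_restrict by unfold_locales
  let ?K = "gwo_kernel (Mor G) (Obj G) (src G)"
  have "subalgebra T ((Mor G)\<lparr>carrier := N1 \<inter> ?K\<rparr>) ((Mor G)\<lparr>carrier := ?K\<rparr>)"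
    using subobject_N1 src.kernel_subobject
    by (auto simp: subalgebra_def subobject_def closed_under_def)
  moreover have "subalgebra T ((Obj G)\<lparr>carrier := N0\<rparr>) (Obj G)"
    by (simp add: subalgebra_iff_subobject subobject_N0)
  ultimately show ?thesis
    using N.crossed_module_of_groupoid crossed_module_of_groupoid
    by (simp add: subcrossed_module_def crossed_module_of_def restrict_groupoid_def
        kernel_restrict gsub_def)
qed

text \<open>
  Ideals absorb products in the second argument by definition, and in the first because
  $n \star a = a \star^\circ n$. The case $n = 1_t$ is the condition $t \star a \in S$ of normality.
\<close>

lemma bin_ideal_left:
  assumes "f \<in> Om2 T" "n \<in> N1" "a \<in> carrier (Mor G)"
  shows "gbin (Mor G) f n a \<in> N1"
  using assms ideal_N1 N1_subset M.opp_closed[of f] M.bin_opp[of f a n]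
  by (force simp: gwo_ideal_def)

text \<open>
  Bracketed as $n + (a - n - a)$, the commutator is a sum of an element of \<open>N1\<close> and a conjugate
  of one. The case $n = 1_t$ is the condition $(t \cdot a) - a \in S$ of normality.
\<close>

lemma commutator_ideal:
  assumes "n \<in> N1" "a \<in> carrier (Mor G)"
  shows "gsub (Mor G) (gsub (Mor G) (gadd (Mor G) n a) n) a \<in> N1"
proof -
  have n: "n \<in> carrier (Mor G)" "gneg (Mor G) n \<in> N1"
    using assms N1_subset subobject_N1 by (auto simp: subobject_def closed_under_def)
  then have "gsub (Mor G) (gadd (Mor G) a (gneg (Mor G) n)) a \<in> N1"
    using ideal_N1 assms by (simp add: M.ideal_iff)
  then have "gadd (Mor G) n (gsub (Mor G) (gadd (Mor G) a (gneg (Mor G) n)) a) \<in> N1"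
    using subobject_N1 assms by (simp add: subobject_def closed_under_def)
  then show ?thesis using n assms by (simp add: gsub_def M.add.m_assoc)
qed

lemma normal_subcrossed_module_restrict:
  "normal_subcrossed_module T (crossed_module_of (restrict_groupoid G N1 N0)) (crossed_module_of G)"
proof -
  let ?M = "Mor G" and ?K = "gwo_kernel (Mor G) (Obj G) (src G)"
  have N0: "t \<in> carrier (Obj G)" if "t \<in> N0" for t using that N0_subset by auto
  have "gsub ?M (gadd ?M (idm G b) s) (idm G b) \<in> N1"
    if "b \<in> carrier (Obj G)" "s \<in> N1" for b s
    using ideal_N1 that by (simp add: M.ideal_iff)
  moreover have "gbin ?M f (idm G b) s \<in> N1"
    if "f \<in> Om2 T" "b \<in> carrier (Obj G)" "s \<in> N1" for f b s
    using ideal_N1 that by (simp add: gwo_ideal_def)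
  moreover have "gsub ?M (gsub ?M (gadd ?M (idm G t) a) (idm G t)) a \<in> N1 \<inter> ?K"
    if t: "t \<in> N0" and a: "a \<in> ?K" for t a
  proof
    show "gsub ?M (gsub ?M (gadd ?M (idm G t) a) (idm G t)) a \<in> N1"
      using commutator_ideal[OF idm_N0[OF t]] a by (simp add: src.mem_kernel_iff)
    show "gsub ?M (gsub ?M (gadd ?M (idm G t) a) (idm G t)) a \<in> ?K"
      using t a N0 by (simp add: src.mem_kernel_iff) (simp add: gsub_def)
  qed
  moreover have "gbin ?M f (idm G t) a \<in> N1 \<inter> ?K"
    if "f \<in> Om2 T" "t \<in> N0" "a \<in> ?K" for f t a
    using that bin_ideal_left idm_N0 star_closed N0 by (auto simp: src.mem_kernel_iff)
  ultimately show ?thesis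
    using subcrossed_module_restrict ideal_N0 dot_closed star_closed
    unfolding normal_subcrossed_module_def Let_def
    by (simp add: crossed_module_of_def restrict_groupoid_def kernel_restrict gsub_def)
qed

end

theorem theorem5p14:
  fixes T :: "('u, 'b) gwo_theory"
    and G :: "('o, 'm, 'u, 'b) int_groupoid"
    and N1 :: "'m set" and N0 :: "'o set"
  assumes "groups_with_operations T"
    and "internal_groupoid T G"
    and "internal_normal_subgroupoid T G N1 N0"
  shows "normal_subcrossed_module T
           (crossed_module_of (restrict_groupoid G N1 N0)) (crossed_module_of G)"
proof -
  interpret normal_subgpd T G N1 N0
    using assms by unfold_locales
  show ?thesis by (rule normal_subcrossed_module_restrict)
qed

end
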